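(* Let $\alpha\in\mathbb{C}$. For every integer $n\ge3$, $$D_{\alpha,n}(\lambda)=(\lambda-2\operatorname{Re}(\alpha))\,U_{n-1}\left(\frac{\lambda-2}{2}\right)-2\operatorname{Re}(\alpha)\,U_{n-2}\left(\frac{\lambda-2}{2}\right)+2(-1)^{n+1}\operatorname{Re}(\alpha).$$
   Context: For $\alpha\in\mathbb{C}$ and an integer $n\ge3$, $L_{\alpha,n}$ is the complex $n\times n$ matrix with entries: $(1,1)$ entry $1+\overline{\alpha}$; $(n,n)$ entry $1+\alpha$; $(k,k)$ entries $2$ for $2\le k\le n-1$; $(k,k+1)$ and $(k+1,k)$ entries $-1$ for $1\le k\le n-1$; $(1,n)$ entry $-\overline{\alpha}$; $(n,1)$ entry $-\alpha$; all other entries $0$. $D_{\alpha,n}(\lambda)=\det(\lambda I_n-L_{\alpha,n})$ is its characteristic polynomial. $U_m$ is the Chebyshev polynomial of the second kind of degree $m$. *)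

theory Defs
  imports Complex_Main "Jordan_Normal_Form.Char_Poly"
begin

text \<open>
  Matrix indices start at 0 here, so the entry \<open>(i, j)\<close> below is the entry \<open>(i + 1, j + 1)\<close>
  in the usual numbering. The off-diagonal cases are mutually exclusive as soon as \<open>n \<ge> 3\<close>.
\<close>

definition L_mat :: "complex \<Rightarrow> nat \<Rightarrow> complex mat" where
  "L_mat \<alpha> n = mat n n (\<lambda>(i, j).
     if i = 0 \<and> j = 0 then 1 + cnj \<alpha>
     else if i = n - 1 \<and> j = n - 1 then 1 + \<alpha>
     else if i = j then 2
     else if j = i + 1 \<or> i = j + 1 then - 1
     else if i = 0 \<and> j = n - 1 then - cnj \<alpha>
     else if i = n - 1 \<and> j = 0 then - \<alpha>
     else 0)"

lemma L_mat_carrier [simp]: "L_mat \<alpha> n \<in> carrier_mat n n"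
  by (simp add: L_mat_def)

definition D_poly :: "complex \<Rightarrow> nat \<Rightarrow> complex \<Rightarrow> complex" where
  "D_poly \<alpha> n \<mu> = det (\<mu> \<cdot>\<^sub>m 1\<^sub>m n - L_mat \<alpha> n)"

lemma D_poly_eq_char_poly: "D_poly \<alpha> n \<mu> = poly (char_poly (L_mat \<alpha> n)) \<mu>"
proof -
  have "poly (char_poly (L_mat \<alpha> n)) \<mu> = det (\<mu> \<cdot>\<^sub>m 1\<^sub>m n - L_mat \<alpha> n)"
    unfolding char_poly_def
    by (rule poly_det_cong[of _ n]) (auto simp: char_poly_matrix_def L_mat_def)
  then show ?thesis
    by (simp add: D_poly_def)
qed

fun Cheb_U :: "nat \<Rightarrow> complex poly" where
  "Cheb_U 0 = 1"
| "Cheb_U (Suc 0) = [:0, 2:]"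
| "Cheb_U (Suc (Suc m)) = [:0, 2:] * Cheb_U (Suc m) - Cheb_U m"

lemma degree_Cheb_U: "degree (Cheb_U m) = m"
proof -
  have "degree (Cheb_U m) = m \<and> degree (Cheb_U (Suc m)) = Suc m"
  proof (induction m)
    case (Suc m)
    then have nz: "Cheb_U (Suc m) \<noteq> 0"
      by auto
    have "degree ([:0, 2:] * Cheb_U (Suc m)) = Suc (Suc m)"
      using Suc nz by (subst degree_mult_eq) auto
    then have "degree (- Cheb_U m + [:0, 2:] * Cheb_U (Suc m)) = Suc (Suc m)"
      using Suc by (subst degree_add_eq_right) auto
    moreover have "Cheb_U (Suc (Suc m)) = - Cheb_U m + [:0, 2:] * Cheb_U (Suc m)"
      by simp
    ultimately show ?case
      using Suc by metis
  qed auto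
  then show ?thesis ..
qed

lemma Cheb_U_cos: "poly (Cheb_U m) (cos t) * sin t = sin (of_nat (m + 1) * t)"
proof (induction m rule: Cheb_U.induct)
  case 2
  show ?case by (simp add: sin_double)
next
  case (3 m)
  define s where "s = of_nat (m + 2) * t"
  have "poly (Cheb_U (Suc (Suc m))) (cos t) * sin t =
      2 * cos t * (poly (Cheb_U (Suc m)) (cos t) * sin t) - poly (Cheb_U m) (cos t) * sin t"
    by (simp add: algebra_simps)
  also have "\<dots> = 2 * cos t * sin s - sin (s - t)"
    unfolding 3 s_def by (simp add: algebra_simps)
  also have "\<dots> = sin (s + t)"
    by (simp add: sin_add sin_diff algebra_simps)
  also have "s + t = of_nat (Suc (Suc m) + 1) * t"
    by (simp add: s_def algebra_simps)
  finally show ?case .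
qed simp

end

theory Submission
  imports Defs
begin

text \<open>
  Put \<open>x = \<mu> - 2\<close>. The matrix \<open>\<mu> I - L\<close> is tridiagonal with off-diagonal entries 1, up to its
  two corners. Expanding along the first row and then along the first column leaves triangular
  minors and tridiagonal ones that differ from a Toeplitz matrix in one corner; the latter
  satisfy the recurrence of \<open>U\<^sub>m(x / 2)\<close>. The terms in \<open>\<bar>\<alpha>\<bar>\<^sup>2\<close> cancel.
\<close>

definition tri_mat :: "nat \<Rightarrow> 'a::comm_ring_1 \<Rightarrow> 'a \<Rightarrow> 'a mat" where
  "tri_mat n x d = mat n n (\<lambda>(i, j).
     if i = j then if i = n - 1 then d else x
     else if j = Suc i \<or> i = Suc j then 1 else 0)"

text \<open>Since \<open>d\<close> sits in the last corner, deleting the first row and column stays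
  in the family. The other minor, \<open>?B\<close>, has a single nonzero entry in its first column,
  which gives the term two sizes down. The case \<open>n = 0\<close> relies on the empty determinant
  being 1.\<close>

lemma det_tri_mat_Suc_Suc:
  "det (tri_mat (Suc (Suc n)) x d) = x * det (tri_mat (Suc n) x d) - det (tri_mat n x d)"
proof -
  let ?A = "tri_mat (Suc (Suc n)) x d"
  let ?B = "mat_delete ?A 0 1"
  have del00: "mat_delete ?A 0 0 = tri_mat (Suc n) x d"
    by (rule eq_matI) (auto simp: mat_delete_def tri_mat_def)
  have del_del: "mat_delete ?B 0 0 = tri_mat n x d"
    by (rule eq_matI) (auto simp: mat_delete_def tri_mat_def)
  have "det ?B = (\<Sum>i<Suc n. ?B $$ (i, 0) * cofactor ?B i 0)"
    by (rule laplace_expansion_column) (auto simp: mat_delete_def tri_mat_def)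
  also have "\<dots> = (\<Sum>i\<in>{0}. ?B $$ (i, 0) * cofactor ?B i 0)"
    by (rule sum.mono_neutral_right) (auto simp: mat_delete_def tri_mat_def)
  also have "\<dots> = det (tri_mat n x d)"
    using del_del by (simp add: cofactor_def) (simp add: mat_delete_def tri_mat_def)
  finally have det_B: "det ?B = det (tri_mat n x d)" .
  have "det ?A = (\<Sum>j<Suc (Suc n). ?A $$ (0, j) * cofactor ?A 0 j)"
    by (rule laplace_expansion_row) (auto simp: tri_mat_def)
  also have "\<dots> = (\<Sum>j\<in>{0, 1}. ?A $$ (0, j) * cofactor ?A 0 j)"
    by (rule sum.mono_neutral_right) (auto simp: tri_mat_def)
  also have "\<dots> = x * det (tri_mat (Suc n) x d) - det ?B"
    using del00 by (simp add: cofactor_def) (simp add: tri_mat_def)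
  finally show ?thesis
    by (simp only: det_B)
qed

text \<open>The determinant is affine in the corner \<open>d\<close>, with the Toeplitz determinant
  of size \<open>n\<close> as slope. Both sides obey the same three-term recurrence, so sizes 1 and
  2 suffice as base cases.\<close>

lemma det_tri_mat_Cheb_U:
  fixes x d :: complex
  shows "det (tri_mat (Suc n) x d) =
    poly (Cheb_U (Suc n)) (x / 2) + (d - x) * poly (Cheb_U n) (x / 2)"
proof (induction n rule: Cheb_U.induct)
  case 1
  show ?case
    by (subst det_single) (auto simp: tri_mat_def)
next
  case 2
  have "det (tri_mat 0 x d) = 1"
    by (simp add: tri_mat_def)
  moreover have "det (tri_mat (Suc 0) x d) = d"
    by (subst det_single) (auto simp: tri_mat_def)
  ultimately show ?case
    by (simp add: det_tri_mat_Suc_Suc algebra_simps)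
next
  case (3 n)
  show ?case
    unfolding det_tri_mat_Suc_Suc[of "Suc n"] 3 by (simp add: algebra_simps)
qed

definition cyclic_tri_mat :: "nat \<Rightarrow> 'a::comm_ring_1 \<Rightarrow> 'a \<Rightarrow> 'a \<Rightarrow> 'a \<Rightarrow> 'a \<Rightarrow> 'a mat" where
  "cyclic_tri_mat n x a b c d = mat n n (\<lambda>(i, j).
     if i = 0 \<and> j = 0 then a
     else if i = n - 1 \<and> j = n - 1 then d
     else if i = j then x
     else if j = Suc i \<or> i = Suc j then 1
     else if i = 0 \<and> j = n - 1 then b
     else if i = n - 1 \<and> j = 0 then c
     else 0)"

text \<open>In terms of permutations: \<open>b * c\<close> comes from swapping the first and last
  index, and the last summand from the two \<open>N\<close>-cycles, whose sign is
  \<open>(- 1) ^ (N - 1) = (- 1) ^ n\<close>. Size at least 3 keeps \<open>b\<close> and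
  \<open>c\<close> apart from the off-diagonal ones.\<close>

lemma det_cyclic_tri_mat:
  fixes n :: nat and x a b c d :: "'a::comm_ring_1"
  defines "N \<equiv> Suc (Suc (Suc n))"
  shows "det (cyclic_tri_mat N x a b c d) =
    a * det (tri_mat (Suc (Suc n)) x d) - det (tri_mat (Suc n) x d)
    - b * c * det (tri_mat (Suc n) x x) + (- 1) ^ n * (b + c)"
proof -
  let ?A = "cyclic_tri_mat N x a b c d"
  let ?B = "mat_delete ?A 0 1"
  let ?C = "mat_delete ?A 0 (Suc (Suc n))"
  have del00: "mat_delete ?A 0 0 = tri_mat (Suc (Suc n)) x d"
    by (rule eq_matI) (auto simp: mat_delete_def tri_mat_def cyclic_tri_mat_def N_def)
  have B0: "mat_delete ?B 0 0 = tri_mat (Suc n) x d"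
    by (rule eq_matI) (auto simp: mat_delete_def tri_mat_def cyclic_tri_mat_def N_def)
  \<comment> \<open>Here both the first and the last row and column are gone, so neither
    \<open>a\<close> nor \<open>d\<close> survives.\<close>
  have C1: "mat_delete ?C (Suc n) 0 = tri_mat (Suc n) x x"
    by (rule eq_matI) (auto simp: mat_delete_def tri_mat_def cyclic_tri_mat_def N_def)
  \<comment> \<open>The deletions shift the superdiagonal of ones onto the diagonal; for
    \<open>C0\<close> below it is the subdiagonal.\<close>
  have B1: "det (mat_delete ?B (Suc n) 0) = 1"
  proof -
    have "det (mat_delete ?B (Suc n) 0) = prod_list (diag_mat (mat_delete ?B (Suc n) 0))"
      by (rule det_lower_triangular[of "Suc n"])
        (auto simp: mat_delete_def cyclic_tri_mat_def N_def)
    also have "\<dots> = 1"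
      by (rule prod_list_neutral)
        (auto simp: diag_mat_def mat_delete_def cyclic_tri_mat_def N_def simp del: upt_Suc)
    finally show ?thesis .
  qed
  have C0: "det (mat_delete ?C 0 0) = 1"
  proof -
    have "det (mat_delete ?C 0 0) = prod_list (diag_mat (mat_delete ?C 0 0))"
      by (rule det_upper_triangular[of _ "Suc n"])
        (auto simp: mat_delete_def cyclic_tri_mat_def N_def)
    also have "\<dots> = 1"
      by (rule prod_list_neutral)
        (auto simp: diag_mat_def mat_delete_def cyclic_tri_mat_def N_def simp del: upt_Suc)
    finally show ?thesis .
  qed
  have "det ?B = (\<Sum>i<Suc (Suc n). ?B $$ (i, 0) * cofactor ?B i 0)"
    by (rule laplace_expansion_column) (auto simp: mat_delete_def cyclic_tri_mat_def N_def)
  also have "\<dots> = (\<Sum>i\<in>{0, Suc n}. ?B $$ (i, 0) * cofactor ?B i 0)"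
    by (rule sum.mono_neutral_right) (auto simp: mat_delete_def cyclic_tri_mat_def N_def)
  also have "\<dots> = ?B $$ (0, 0) * det (tri_mat (Suc n) x d) + ?B $$ (Suc n, 0) * (- 1) ^ Suc n"
    using B0 B1 by (simp add: cofactor_def)
  finally have det_B: "det ?B = det (tri_mat (Suc n) x d) - (- 1) ^ n * c"
    by (simp add: mat_delete_def cyclic_tri_mat_def N_def)
  have "det ?C = (\<Sum>i<Suc (Suc n). ?C $$ (i, 0) * cofactor ?C i 0)"
    by (rule laplace_expansion_column) (auto simp: mat_delete_def cyclic_tri_mat_def N_def)
  also have "\<dots> = (\<Sum>i\<in>{0, Suc n}. ?C $$ (i, 0) * cofactor ?C i 0)"
    by (rule sum.mono_neutral_right) (auto simp: mat_delete_def cyclic_tri_mat_def N_def)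
  also have "\<dots> = ?C $$ (0, 0) + ?C $$ (Suc n, 0) * ((- 1) ^ Suc n * det (tri_mat (Suc n) x x))"
    using C0 C1 by (simp add: cofactor_def)
  finally have det_C: "det ?C = 1 - (- 1) ^ n * c * det (tri_mat (Suc n) x x)"
    by (simp add: mat_delete_def cyclic_tri_mat_def N_def)
  have "det ?A = (\<Sum>j<N. ?A $$ (0, j) * cofactor ?A 0 j)"
    by (rule laplace_expansion_row) (auto simp: cyclic_tri_mat_def N_def)
  also have "\<dots> = (\<Sum>j\<in>{0, 1, Suc (Suc n)}. ?A $$ (0, j) * cofactor ?A 0 j)"
    by (rule sum.mono_neutral_right) (auto simp: cyclic_tri_mat_def N_def)
  also have "\<dots> = ?A $$ (0, 0) * det (tri_mat (Suc (Suc n)) x d) - ?A $$ (0, 1) * det ?B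
      + ?A $$ (0, Suc (Suc n)) * ((- 1) ^ n * det ?C)"
    using del00 by (simp add: cofactor_def algebra_simps)
  also have "\<dots> = a * det (tri_mat (Suc (Suc n)) x d) - det ?B + b * ((- 1) ^ n * det ?C)"
    by (simp add: cyclic_tri_mat_def N_def)
  \<comment> \<open>The sign of the cofactor of \<open>b\<close> and the sign inside
    \<open>det ?C\<close> multiply to 1, so the \<open>b * c\<close> term carries no power of
    -1.\<close>
  finally show ?thesis
    unfolding det_B det_C
    by (simp add: algebra_simps flip: power_add mult_2)
qed

theorem proposition13:
  fixes \<alpha> \<mu> :: complex and n :: nat
  assumes "n \<ge> 3"
  shows "D_poly \<alpha> n \<mu> =
    (\<mu> - 2 * of_real (Re \<alpha>)) * poly (Cheb_U (n - 1)) ((\<mu> - 2) / 2)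
    - 2 * of_real (Re \<alpha>) * poly (Cheb_U (n - 2)) ((\<mu> - 2) / 2)
    + 2 * (- 1) ^ (n + 1) * of_real (Re \<alpha>)"
proof -
  obtain k where n: "n = Suc (Suc (Suc k))"
    using assms by (metis Suc_le_D Suc_le_mono numeral_3_eq_3)
  have "\<mu> \<cdot>\<^sub>m 1\<^sub>m n - L_mat \<alpha> n =
      cyclic_tri_mat n (\<mu> - 2) (\<mu> - 1 - cnj \<alpha>) (cnj \<alpha>) \<alpha> (\<mu> - 1 - \<alpha>)"
    by (rule eq_matI) (auto simp: L_mat_def cyclic_tri_mat_def n)
  \<comment> \<open>Eliminating the conjugate turns the claim into a polynomial identity and
    \<open>b + c\<close> into twice the real part.\<close>
  moreover have "cnj \<alpha> = 2 * of_real (Re \<alpha>) - \<alpha>"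
    by (simp add: complex_eq_iff)
  ultimately show ?thesis
    unfolding D_poly_def n det_cyclic_tri_mat
    \<comment> \<open>The second call expands \<open>Cheb_U (Suc (Suc k))\<close> by its recurrence,
      leaving a ring identity in the values of \<open>Cheb_U (Suc k)\<close> and
      \<open>Cheb_U k\<close>.\<close>
    by (simp add: det_cyclic_tri_mat det_tri_mat_Cheb_U del: Cheb_U.simps)
      (simp add: field_simps)
qed

end
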